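(* Let $\mathcal T=\{(x,\xi):0\le\xi\le x\le1\}$. Assume $q_i,h_i\in\mathcal C([0,1])$, $g_i,C_{ji}\in\mathcal C(\mathcal T)$ for $i,j=1,2,3,4$, and $\epsilon_1,\epsilon_2\in\mathcal C([0,1])$ with $\epsilon_1(x),\epsilon_2(x)>0$. Then the hyperbolic system on $\mathcal T$ $$\epsilon_1(x)F^1_x+\epsilon_1(\xi)F^1_\xi=g_1(x,\xi)+\sum_{i=1}^4C_{1i}(x,\xi)F^i(x,\xi),$$ $$\epsilon_1(x)F^2_x-\epsilon_2(\xi)F^2_\xi=g_2(x,\xi)+\sum_{i=1}^4C_{2i}(x,\xi)F^i(x,\xi),$$ $$\epsilon_2(x)F^3_x-\epsilon_1(\xi)F^3_\xi=g_3(x,\xi)+\sum_{i=1}^4C_{3i}(x,\xi)F^i(x,\xi),$$ $$\epsilon_2(x)F^4_x+\epsilon_2(\xi)F^4_\xi=g_4(x,\xi)+\sum_{i=1}^4C_{4i}(x,\xi)F^i(x,\xi),$$ with boundary conditions, for $x\in[0,1]$, $$F^1(x,0)=h_1(x)+q_1(x)F^2(x,0)+q_2(x)F^3(x,0),$$ $$F^2(x,x)=h_2(x),\qquad F^3(x,x)=h_3(x),$$ $$F^4(x,0)=h_4(x)+q_3(x)F^2(x,0)+q_4(x)F^3(x,0),$$ has a unique solution $F^i\in\mathcal C(\mathcal T)$, $i=1,2,3,4$.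
   Context: Since the $F^i$ are only required to be continuous, the equations are understood along characteristics: the left-hand side of each equation is the derivative of $F^j$ along the curves in $\mathcal T$ solving, respectively, $(\dot x,\dot\xi)=(\epsilon_1(x),\epsilon_1(\xi))$ for $j=1$, $(\epsilon_1(x),-\epsilon_2(\xi))$ for $j=2$, $(\epsilon_2(x),-\epsilon_1(\xi))$ for $j=3$, $(\epsilon_2(x),\epsilon_2(\xi))$ for $j=4$. A $\mathcal C(\mathcal T)$ solution is a continuous $(F^1,\dots,F^4)$ satisfying the boundary conditions and the equations integrated along these curves (starting from the boundary $\xi=0$ for $j=1,4$ and from the boundary $x=\xi$ for $j=2,3$). *)

theory Defs
  imports "HOL-Analysis.Analysis"
begin

definition triangle_domain :: "(real \<times> real) set" where
  "triangle_domain = {(x, \<xi>). 0 \<le> \<xi> \<and> \<xi> \<le> x \<and> x \<le> 1}"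

definition bottom_edge :: "(real \<times> real) set" where
  "bottom_edge = {(x, 0) |x. 0 \<le> x \<and> x \<le> 1}"

definition diagonal_edge :: "(real \<times> real) set" where
  "diagonal_edge = {(x, x) |x. 0 \<le> x \<and> x \<le> 1}"

text \<open>Derivatives at the end points \<open>0\<close> and \<open>s\<close> of the parameter interval are one-sided.\<close>

definition characteristic ::
  "(real \<Rightarrow> real) \<Rightarrow> (real \<Rightarrow> real) \<Rightarrow> real \<Rightarrow> (real \<Rightarrow> real \<times> real) \<Rightarrow> bool" where
  "characteristic a b s \<gamma> \<longleftrightarrow> 0 \<le> s \<and>
     (\<forall>t\<in>{0..s}. \<gamma> t \<in> triangle_domain \<and>
        (\<gamma> has_vector_derivative (a (fst (\<gamma> t)), b (snd (\<gamma> t)))) (at t within {0..s}))"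

text \<open>
  The equation \<open>a(x) f\<^sub>x + b(\<xi>) f\<^sub>\<xi> = r(x, \<xi>)\<close> for a merely continuous \<open>f\<close>, integrated along
  the characteristics that start in \<open>B\<close>. It is enough to integrate up to the end point \<open>s\<close>,
  since the restriction of a characteristic to a shorter interval \<open>{0..t}\<close> is again a
  characteristic.
\<close>

definition transport_eq ::
  "(real \<Rightarrow> real) \<Rightarrow> (real \<Rightarrow> real) \<Rightarrow> (real \<times> real) set
     \<Rightarrow> (real \<times> real \<Rightarrow> real) \<Rightarrow> (real \<times> real \<Rightarrow> real) \<Rightarrow> bool" where
  "transport_eq a b B f r \<longleftrightarrow>
     (\<forall>s \<gamma>. characteristic a b s \<gamma> \<and> \<gamma> 0 \<in> B \<longrightarrow>
        ((\<lambda>t. r (\<gamma> t)) has_integral (f (\<gamma> s) - f (\<gamma> 0))) {0..s})"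

definition source ::
  "(nat \<Rightarrow> real \<times> real \<Rightarrow> real) \<Rightarrow> (nat \<Rightarrow> nat \<Rightarrow> real \<times> real \<Rightarrow> real)
     \<Rightarrow> (nat \<Rightarrow> real \<times> real \<Rightarrow> real) \<Rightarrow> nat \<Rightarrow> real \<times> real \<Rightarrow> real" where
  "source g C F j p = g j p + (\<Sum>i=1..4. C j i p * F i p)"

text \<open>
  Families indexed by \<open>1, \<dots>, 4\<close> are functions on \<^typ>\<open>nat\<close>; only their values at these
  indices, and on the triangle or the unit interval, matter.
\<close>

definition hyperbolic_solution ::
  "(real \<Rightarrow> real) \<Rightarrow> (real \<Rightarrow> real) \<Rightarrow> (nat \<Rightarrow> real \<Rightarrow> real) \<Rightarrow> (nat \<Rightarrow> real \<Rightarrow> real)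
     \<Rightarrow> (nat \<Rightarrow> real \<times> real \<Rightarrow> real) \<Rightarrow> (nat \<Rightarrow> nat \<Rightarrow> real \<times> real \<Rightarrow> real)
     \<Rightarrow> (nat \<Rightarrow> real \<times> real \<Rightarrow> real) \<Rightarrow> bool" where
  "hyperbolic_solution \<epsilon>1 \<epsilon>2 q h g C F \<longleftrightarrow>
     (\<forall>i\<in>{1..4}. continuous_on triangle_domain (F i)) \<and>
     transport_eq \<epsilon>1 \<epsilon>1 bottom_edge (F 1) (source g C F 1) \<and>
     transport_eq \<epsilon>1 (\<lambda>\<xi>. - \<epsilon>2 \<xi>) diagonal_edge (F 2) (source g C F 2) \<and>
     transport_eq \<epsilon>2 (\<lambda>\<xi>. - \<epsilon>1 \<xi>) diagonal_edge (F 3) (source g C F 3) \<and>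
     transport_eq \<epsilon>2 \<epsilon>2 bottom_edge (F 4) (source g C F 4) \<and>
     (\<forall>x\<in>{0..1}.
        F 1 (x, 0) = h 1 x + q 1 x * F 2 (x, 0) + q 2 x * F 3 (x, 0) \<and>
        F 2 (x, x) = h 2 x \<and>
        F 3 (x, x) = h 3 x \<and>
        F 4 (x, 0) = h 4 x + q 3 x * F 2 (x, 0) + q 4 x * F 3 (x, 0))"

end

theory Submission
  imports Defs
begin

text \<open>
  Integrating \<open>1 / \<epsilon>\<^sub>1\<close> and \<open>1 / \<epsilon>\<^sub>2\<close> gives travel times in which all characteristics become straight
  lines of unit speed. Hence through each point of the triangle passes exactly one characteristic
  coming from the relevant edge, and it depends continuously on the point; this turns the system
  into a fixed point equation for continuous functions. Along all four families \<open>x\<close> increases with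
  speed bounded below, and the boundary values at \<open>\<xi> = 0\<close> can be replaced by the integral formulas
  for \<open>F\<^sub>2\<close> and \<open>F\<^sub>3\<close>. So the fixed point operator is a contraction in the supremum norm weighted
  by \<open>exp (- l * x)\<close> for large \<open>l\<close>.
\<close>

section \<open>A weighted contraction principle\<close>

text \<open>Banach's fixed point theorem for finite families of continuous functions with the norm
  given by the maximum over \<open>i\<close> of the supremum of
  \<open>\<bar>F i p\<bar> / w p\<close>. Distances are expressed as bounds \<open>M * w p\<close>,
  so families need to be controlled only at indices in \<open>J\<close> and points of
  \<open>S\<close>, and uniqueness is claimed only there.\<close>

lemma weighted_contraction_fixpoint:
  fixes \<Phi> :: "('i \<Rightarrow> 'a::topological_space \<Rightarrow> real) \<Rightarrow> 'i \<Rightarrow> 'a \<Rightarrow> real"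
  assumes S: "compact S" and J: "finite J"
    and w: "continuous_on S w" and wpos: "\<And>p. p \<in> S \<Longrightarrow> 0 < w p"
    and cont: "\<And>F j. (\<And>i. i \<in> J \<Longrightarrow> continuous_on S (F i)) \<Longrightarrow> j \<in> J \<Longrightarrow> continuous_on S (\<Phi> F j)"
    and contr: "\<And>F G M j p. (\<And>i. i \<in> J \<Longrightarrow> continuous_on S (F i)) \<Longrightarrow>
        (\<And>i. i \<in> J \<Longrightarrow> continuous_on S (G i)) \<Longrightarrow> 0 \<le> M \<Longrightarrow>
        (\<And>i p. i \<in> J \<Longrightarrow> p \<in> S \<Longrightarrow> \<bar>F i p - G i p\<bar> \<le> M * w p) \<Longrightarrow>
        j \<in> J \<Longrightarrow> p \<in> S \<Longrightarrow> \<bar>\<Phi> F j p - \<Phi> G j p\<bar> \<le> M / 2 * w p"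
  obtains F where "\<And>i. i \<in> J \<Longrightarrow> continuous_on S (F i)"
    and "\<And>i p. i \<in> J \<Longrightarrow> p \<in> S \<Longrightarrow> \<Phi> F i p = F i p"
    and "\<And>G i p. (\<And>i. i \<in> J \<Longrightarrow> continuous_on S (G i)) \<Longrightarrow>
        (\<And>i p. i \<in> J \<Longrightarrow> p \<in> S \<Longrightarrow> \<Phi> G i p = G i p) \<Longrightarrow> i \<in> J \<Longrightarrow> p \<in> S \<Longrightarrow> G i p = F i p"
proof -
  define Co where "Co F \<longleftrightarrow> (\<forall>i\<in>J. continuous_on S (F i))" for F :: "'i \<Rightarrow> 'a \<Rightarrow> real"
  \<comment> \<open>Finite distance: the quotient by the positive weight is continuous on a compact
    set, and summing over the finite \<open>J\<close> merges the bounds of the components.\<close>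
  have bound: "\<exists>M\<ge>0. \<forall>i\<in>J. \<forall>p\<in>S. \<bar>F i p - G i p\<bar> \<le> M * w p" if "Co F" "Co G" for F G
  proof -
    have "\<exists>B\<ge>0. \<forall>p\<in>S. \<bar>F i p - G i p\<bar> \<le> B * w p" if "i \<in> J" for i
    proof -
      have "continuous_on S (\<lambda>p. (F i p - G i p) / w p)"
        using \<open>Co F\<close> \<open>Co G\<close> \<open>i \<in> J\<close> w wpos unfolding Co_def
        by (intro continuous_intros) force+
      then have "bounded ((\<lambda>p. (F i p - G i p) / w p) ` S)"
        by (intro compact_imp_bounded compact_continuous_image S)
      then obtain B where B: "B > 0" "\<And>p. p \<in> S \<Longrightarrow> \<bar>(F i p - G i p) / w p\<bar> \<le> B"
        unfolding bounded_pos by auto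
      then show ?thesis
        using wpos by (intro exI[of _ B]) (simp add: abs_divide divide_le_eq abs_of_pos)
    qed
    then obtain B where B: "\<And>i. i \<in> J \<Longrightarrow> B i \<ge> 0"
      "\<And>i p. i \<in> J \<Longrightarrow> p \<in> S \<Longrightarrow> \<bar>F i p - G i p\<bar> \<le> B i * w p"
      by metis
    show ?thesis
    proof (intro exI[of _ "sum B J"] conjI ballI)
      show "0 \<le> sum B J" using B by (simp add: sum_nonneg)
      fix i p assume ip: "i \<in> J" "p \<in> S"
      have "B i \<le> sum B J" using ip B J by (intro member_le_sum) auto
      then have "B i * w p \<le> sum B J * w p" using wpos ip by (intro mult_right_mono) (auto simp: less_imp_le)
      with B(2)[OF ip] show "\<bar>F i p - G i p\<bar> \<le> sum B J * w p" by simp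
    qed
  qed
  have Co_step: "Co (\<Phi> F)" if "Co F" for F
    using that cont[of F] unfolding Co_def by blast
  have contr': "\<forall>j\<in>J. \<forall>p\<in>S. \<bar>\<Phi> F j p - \<Phi> G j p\<bar> \<le> M / 2 * w p"
    if "Co F" "Co G" "0 \<le> M" "\<forall>i\<in>J. \<forall>p\<in>S. \<bar>F i p - G i p\<bar> \<le> M * w p" for F G M
    using that contr[of F G M] unfolding Co_def by blast
  \<comment> \<open>Picard iteration from the zero family, so that the increments telescope to
    \<open>it n\<close> itself.\<close>
  define it where "it n = (\<Phi> ^^ n) (\<lambda>_ _. 0)" for n
  have it_0: "it 0 = (\<lambda>_ _. 0)" and it_Suc: "it (Suc n) = \<Phi> (it n)" for n
    by (simp_all add: it_def)
  have Co_it: "Co (it n)" for n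
    by (induction n) (simp_all add: it_Suc Co_step, simp add: it_0 Co_def)
  obtain M where M: "0 \<le> M" "\<forall>i\<in>J. \<forall>p\<in>S. \<bar>it 1 i p - it 0 i p\<bar> \<le> M * w p"
    using bound[OF Co_it Co_it] by blast
  have step: "\<forall>i\<in>J. \<forall>p\<in>S. \<bar>it (Suc n) i p - it n i p\<bar> \<le> M / 2 ^ n * w p" for n
  proof (induction n)
    case 0 then show ?case using M by simp
  next
    case (Suc n)
    show ?case
      using contr'[OF Co_it Co_it _ Suc.IH] M by (simp add: it_Suc mult.commute)
  qed
  \<comment> \<open>The bounds \<open>W\<close> and \<open>m\<close> on the weight translate between
    weighted estimates and plain uniform convergence; an empty \<open>S\<close> needs a separate
    choice since no extremum is attained.\<close>
  obtain W where W: "\<And>p. p \<in> S \<Longrightarrow> w p \<le> W"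
  proof (cases "S = {}")
    case False
    then show ?thesis using continuous_attains_sup[OF S _ w] that by blast
  qed (use that in blast)
  obtain m where m: "0 < m" "\<And>p. p \<in> S \<Longrightarrow> m \<le> w p"
  proof (cases "S = {}")
    case False
    then show ?thesis using continuous_attains_inf[OF S _ w] wpos that by blast
  qed (use that[of 1] in simp)
  \<comment> \<open>The limit is the telescoping series of increments, which is dominated by a
    geometric series of ratio 1/2.\<close>
  define L where "L i p = (\<Sum>n. it (Suc n) i p - it n i p)" for i p
  have lim: "uniform_limit S (\<lambda>n. it n i) (L i) sequentially" if "i \<in> J" for i
  proof -
    have "uniform_limit S (\<lambda>n p. \<Sum>k<n. it (Suc k) i p - it k i p) (L i) sequentially"
      unfolding L_def
    proof (rule Weierstrass_m_test)
      fix n p assume "p \<in> S"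
      have "\<bar>it (Suc n) i p - it n i p\<bar> \<le> M / 2 ^ n * w p" using step \<open>i \<in> J\<close> \<open>p \<in> S\<close> by blast
      also have "\<dots> \<le> M / 2 ^ n * W" using W \<open>p \<in> S\<close> M by (intro mult_left_mono) auto
      finally show "norm (it (Suc n) i p - it n i p) \<le> M * W * (1 / 2) ^ n"
        by (simp add: power_divide mult.commute mult.left_commute)
    next
      show "summable (\<lambda>n. M * W * (1 / 2) ^ n)" by (intro summable_mult summable_geometric) simp
    qed
    moreover have "(\<Sum>k<n. it (Suc k) i p - it k i p) = it n i p" for n p
      using sum_lessThan_telescope[of "\<lambda>k. it k i p" n] by (simp add: it_0)
    ultimately show ?thesis by simp
  qed
  have CoL: "Co L"
    unfolding Co_def
  proof
    fix i assume "i \<in> J"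
    show "continuous_on S (L i)"
      by (rule uniform_limit_theorem[OF _ lim[OF \<open>i \<in> J\<close>]])
        (use Co_it \<open>i \<in> J\<close> in \<open>auto simp: Co_def\<close>)
  qed
  have fixL: "\<Phi> L i p = L i p" if ip: "i \<in> J" "p \<in> S" for i p
  proof -
    \<comment> \<open>Both \<open>\<Phi> L\<close> and \<open>L\<close> are compared with
      \<open>\<Phi> (it N) = it (Suc N)\<close>. With \<open>d * w p = e / 2\<close> the two errors
      add up to at most \<open>3 / 4 * e\<close>. The summand \<open>0\<close> only fits the form of
      \<open>field_le_epsilon\<close>.\<close>
    have "\<bar>\<Phi> L i p - L i p\<bar> \<le> 0 + e" if "e > 0" for e
    proof -
      define d where "d = e / (2 * w p)"
      have d: "d > 0" using \<open>e > 0\<close> wpos ip by (simp add: d_def)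
      have ev: "\<forall>\<^sub>F n in sequentially. \<forall>i\<in>J. \<forall>p\<in>S. \<bar>it n i p - L i p\<bar> < d * m"
        using uniform_limitD[OF lim, of _ "d * m"] d m J
        by (intro eventually_ball_finite) (auto simp: dist_real_def)
      obtain N where N: "\<And>n. n \<ge> N \<Longrightarrow> \<forall>i\<in>J. \<forall>p\<in>S. \<bar>it n i p - L i p\<bar> < d * m"
        using ev unfolding eventually_sequentially by blast
      have N': "\<forall>i\<in>J. \<forall>p\<in>S. \<bar>it n i p - L i p\<bar> \<le> d * w p" if "n \<ge> N" for n
      proof (intro ballI)
        fix i p assume "i \<in> J" "p \<in> S"
        then have "\<bar>it n i p - L i p\<bar> < d * m" using N[OF that] by blast
        also have "\<dots> \<le> d * w p" using m d \<open>p \<in> S\<close> by simp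
        finally show "\<bar>it n i p - L i p\<bar> \<le> d * w p" by simp
      qed
      have "\<bar>\<Phi> (it N) i p - \<Phi> L i p\<bar> \<le> d / 2 * w p"
        using contr'[OF Co_it CoL _ N'] d ip by simp
      moreover have "\<bar>\<Phi> (it N) i p - L i p\<bar> \<le> d * w p"
        using N'[of "Suc N"] ip by (simp add: it_Suc)
      moreover have "0 \<le> d * w p" using d wpos[OF ip(2)] by simp
      moreover have "d * w p = e / 2" using wpos[OF ip(2)] by (simp add: d_def)
      ultimately show ?thesis by linarith
    qed
    then have "\<bar>\<Phi> L i p - L i p\<bar> \<le> 0" by (rule field_le_epsilon)
    then show ?thesis by simp
  qed
  have uniq: "G i p = L i p"
    if G: "Co G" "\<And>i p. i \<in> J \<Longrightarrow> p \<in> S \<Longrightarrow> \<Phi> G i p = G i p" and ip: "i \<in> J" "p \<in> S" for G i p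
  proof -
    obtain M where M: "0 \<le> M" "\<forall>i\<in>J. \<forall>p\<in>S. \<bar>G i p - L i p\<bar> \<le> M * w p"
      using bound[OF G(1) CoL] by blast
    \<comment> \<open>Applying \<open>\<Phi>\<close> leaves the two fixed points unchanged but
      halves the bound on their distance.\<close>
    have le: "\<forall>i\<in>J. \<forall>p\<in>S. \<bar>G i p - L i p\<bar> \<le> M / 2 ^ n * w p" for n
    proof (induction n)
      case 0 then show ?case using M by simp
    next
      case (Suc n)
      have "\<forall>i\<in>J. \<forall>p\<in>S. \<bar>\<Phi> G i p - \<Phi> L i p\<bar> \<le> M / 2 ^ n / 2 * w p"
        using M by (intro contr'[OF G(1) CoL _ Suc.IH]) simp
      then show ?case using G(2) fixL by (simp add: mult.commute)
    qed
    have "(\<lambda>n. M * w p * (1 / 2) ^ n) \<longlonglongrightarrow> M * w p * 0"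
      by (intro tendsto_mult LIMSEQ_realpow_zero tendsto_const) auto
    moreover have "\<bar>G i p - L i p\<bar> \<le> M * w p * (1 / 2) ^ n" for n
      using le[of n] ip by (simp add: power_divide)
    ultimately have "\<bar>G i p - L i p\<bar> \<le> M * w p * 0"
      by (intro LIMSEQ_le_const) auto
    then show ?thesis by simp
  qed
  show thesis
  proof (rule that)
    show "continuous_on S (L i)" if "i \<in> J" for i
      using CoL that unfolding Co_def by blast
  next
    fix G i p
    assume "\<And>i. i \<in> J \<Longrightarrow> continuous_on S (G i)"
      and "\<And>i p. i \<in> J \<Longrightarrow> p \<in> S \<Longrightarrow> \<Phi> G i p = G i p" and "i \<in> J" "p \<in> S"
    then show "G i p = L i p" using uniq[of G i p] unfolding Co_def by blast
  qed (fact fixL)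
qed

section \<open>Characteristics\<close>

text \<open>The slope bound \<open>c\<close> makes \<open>f\<close> injective and unbounded in both
  directions, hence onto by the intermediate value theorem, and makes the inverse Lipschitz with
  constant \<open>1 / c\<close>.\<close>

lemma expanding_homeomorphism:
  fixes f :: "real \<Rightarrow> real"
  assumes f: "continuous_on UNIV f" and c: "0 < c"
    and exp: "\<And>x y. x \<le> y \<Longrightarrow> c * (y - x) \<le> f y - f x"
  obtains g where "continuous_on UNIV g" "strict_mono g" "\<And>x. g (f x) = x" "\<And>t. f (g t) = t"
proof -
  have mono: "f x < f y" if "x < y" for x y
    using exp[of x y] mult_pos_pos[OF c, of "y - x"] that by simp
  have "\<exists>x. f x = t" for t
  proof -
    \<comment> \<open>Over a length \<open>r\<close> the function \<open>f\<close> changes by at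
      least \<open>\<bar>t - f 0\<bar>\<close>, so \<open>t\<close> is attained between
      \<open>- r\<close> and \<open>r\<close>.\<close>
    define r where "r = \<bar>t - f 0\<bar> / c"
    have r: "0 \<le> r" "c * r = \<bar>t - f 0\<bar>" using c by (auto simp: r_def)
    have "f (- r) \<le> t" "t \<le> f r" using exp[of "- r" 0] exp[of 0 r] r by auto
    then show ?thesis
      using IVT'[of f "- r" t r] r(1) continuous_on_subset[OF f] by auto
  qed
  then obtain g where fg: "\<And>t. f (g t) = t" by metis
  have gf: "g (f x) = x" for x
    using mono[of "g (f x)" x] mono[of x "g (f x)"] fg[of "f x"] by (cases rule: linorder_cases) auto
  have gm: "strict_mono g"
    by (rule strict_monoI) (metis fg mono linorder_neqE less_asym)
  have "c * \<bar>g u - g t\<bar> \<le> \<bar>u - t\<bar>" for u t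
    using exp[of "g u" "g t"] exp[of "g t" "g u"] fg by (cases "g u \<le> g t") auto
  then have "(1 / c)-lipschitz_on UNIV g"
    using c by (intro lipschitz_onI) (auto simp: dist_real_def field_simps)
  then have "continuous_on UNIV g" by (rule lipschitz_on_continuous_on)
  then show thesis using gm gf fg by (rule that)
qed

text \<open>Here \<open>\<phi> x\<close> is the time needed to move from \<open>0\<close> to
  \<open>x\<close> at speed \<open>a\<close>, an antiderivative of \<open>1 / a\<close>. It is
  wanted on the whole line, so that its inverse is total and the derivatives at \<open>0\<close> and
  \<open>1\<close> are two-sided.\<close>

lemma travel_time:
  fixes a :: "real \<Rightarrow> real"
  assumes a: "continuous_on {0..1} a" and pos: "\<And>x. x \<in> {0..1} \<Longrightarrow> 0 < a x"
  obtains \<phi> c where "0 < c" "continuous_on UNIV \<phi>" "\<phi> 0 = 0"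
    "\<And>x y. x \<le> y \<Longrightarrow> c * (y - x) \<le> \<phi> y - \<phi> x"
    "\<And>x. x \<in> {0..1} \<Longrightarrow> (\<phi> has_real_derivative 1 / a x) (at x)"
proof -
  \<comment> \<open>The speed is frozen at its end point values outside the unit interval.\<close>
  define b where "b x = a (max 0 (min 1 x))" for x
  have b_pos: "b x > 0" for x unfolding b_def by (intro pos) auto
  have b: "continuous_on UNIV b"
    unfolding b_def by (intro continuous_on_compose2[OF a] continuous_intros) auto
  obtain x0 where "\<forall>y\<in>{0..1}. a y \<le> a x0"
    using continuous_attains_sup[OF _ _ a] by auto
  then have b_le: "b x \<le> a x0" for x unfolding b_def by auto
  have a0: "0 < a x0" using b_pos[of 0] b_le[of 0] by simp
  have "\<exists>F. \<forall>x :: real. -\<infinity> < ereal x \<longrightarrow> ereal x < \<infinity> \<longrightarrow> (F has_vector_derivative 1 / b x) (at x)"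
  proof (rule einterval_antiderivative)
    show "isCont (\<lambda>x. 1 / b x) x" for x
      using b b_pos by (intro continuous_intros) (auto simp: continuous_on_eq_continuous_at less_imp_neq[symmetric])
  qed simp
  then obtain F where F: "\<And>x. (F has_real_derivative 1 / b x) (at x)"
    by (auto simp: has_real_derivative_iff_has_vector_derivative)
  define \<phi> where "\<phi> x = F x - F 0" for x
  have d: "(\<phi> has_real_derivative 1 / b x) (at x)" for x
    unfolding \<phi>_def by (auto intro!: derivative_eq_intros F)
  show thesis
  proof (rule that[of "1 / a x0" \<phi>])
    show "continuous_on UNIV \<phi>"
      using d by (meson DERIV_isCont continuous_at_imp_continuous_on)
    show "1 / a x0 * (y - x) \<le> \<phi> y - \<phi> x" if "x \<le> y" for x y
    proof (cases "x < y")
      case True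
      then obtain z where "\<phi> y - \<phi> x = (y - x) * (1 / b z)" using MVT2[of x y \<phi> "\<lambda>x. 1 / b x"] d by blast
      moreover have "1 / a x0 \<le> 1 / b z" using b_le[of z] b_pos[of z] by (simp add: frac_le)
      ultimately show ?thesis using mult_right_mono[of "1 / a x0" "1 / b z" "y - x"] True
        by (simp add: mult.commute)
    qed (use that in auto)
    show "(\<phi> has_real_derivative 1 / a x) (at x)" if "x \<in> {0..1}" for x
    proof -
      have "max 0 (min 1 x) = x" using that by auto
      then show ?thesis using d[of x] by (simp add: b_def)
    qed
  qed (use a0 in \<open>auto simp: \<phi>_def\<close>)
qed

text \<open>Separation of variables: the factor \<open>1 / a (u t)\<close> from the chain rule
  cancels the speed. This yields uniqueness of characteristics without a Lipschitz condition on
  \<open>a\<close>; the sign of \<open>\<sigma>\<close> is the direction of motion.\<close>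

lemma travel_time_along_solution:
  fixes u a \<phi> :: "real \<Rightarrow> real"
  assumes \<phi>: "\<And>x. x \<in> {0..1} \<Longrightarrow> (\<phi> has_real_derivative 1 / a x) (at x)"
    and pos: "\<And>x. x \<in> {0..1} \<Longrightarrow> 0 < a x"
    and u: "\<And>t. t \<in> {0..s} \<Longrightarrow> u t \<in> {0..1} \<and> (u has_real_derivative \<sigma> * a (u t)) (at t within {0..s})"
    and t: "t \<in> {0..s}"
  shows "\<phi> (u t) = \<phi> (u 0) + \<sigma> * t"
proof -
  have "\<exists>c. \<forall>t\<in>{0..s}. \<phi> (u t) - \<sigma> * t = c"
  proof (rule has_field_derivative_zero_constant)
    fix r assume "r \<in> {0..s}"
    note ur = conjunct1[OF u[OF this]] conjunct2[OF u[OF this]]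
    have "((\<lambda>t. \<phi> (u t) - \<sigma> * t) has_real_derivative 1 / a (u r) * (\<sigma> * a (u r)) - \<sigma> * 1) (at r within {0..s})"
      by (intro DERIV_diff DERIV_cmult DERIV_ident DERIV_chain2[OF \<phi>[OF ur(1)] ur(2)])
    then show "((\<lambda>t. \<phi> (u t) - \<sigma> * t) has_real_derivative 0) (at r within {0..s})"
      using pos[OF ur(1)] by simp
  qed simp
  then obtain c where c: "\<And>t. t \<in> {0..s} \<Longrightarrow> \<phi> (u t) - \<sigma> * t = c" by blast
  show ?thesis using c[OF t] c[of 0] t by auto
qed

text \<open>The converse, giving existence: the inverse \<open>\<psi>\<close> of the travel time has
  derivative \<open>a\<close> composed with \<open>\<psi>\<close>, so uniform motion in travel time
  solves the equation.\<close>

lemma solution_of_travel_time: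
  fixes a \<phi> \<psi> :: "real \<Rightarrow> real"
  assumes \<phi>: "\<And>x. x \<in> {0..1} \<Longrightarrow> (\<phi> has_real_derivative 1 / a x) (at x)"
    and pos: "\<And>x. x \<in> {0..1} \<Longrightarrow> 0 < a x"
    and \<psi>: "continuous_on UNIV \<psi>" "\<And>t. \<phi> (\<psi> t) = t"
    and mem: "\<psi> (k + \<sigma> * t) \<in> {0..1}"
  shows "((\<lambda>t. \<psi> (k + \<sigma> * t)) has_real_derivative \<sigma> * a (\<psi> (k + \<sigma> * t))) (at t within S)"
proof -
  let ?y = "k + \<sigma> * t"
  have "(\<psi> has_real_derivative inverse (1 / a (\<psi> ?y))) (at ?y)"
  proof (rule DERIV_inverse_function[where f = \<phi> and a = "?y - 1" and b = "?y + 1"])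
    show "isCont \<psi> ?y" using \<psi>(1) by (simp add: continuous_on_eq_continuous_at)
  qed (use \<phi>[OF mem] pos[OF mem] \<psi>(2) in auto)
  then have *: "(\<psi> has_real_derivative a (\<psi> ?y)) (at ?y)" by simp
  have "((\<lambda>t. k + \<sigma> * t) has_real_derivative \<sigma>) (at t within S)"
    by (auto intro!: derivative_eq_intros)
  from DERIV_chain2[OF * this] show ?thesis by (simp add: mult.commute)
qed

section \<open>The triangle and its characteristics\<close>

lemma compact_triangle_domain: "compact triangle_domain"
proof -
  have "triangle_domain = ({0..1} \<times> {0..1}) \<inter> {p. snd p \<le> fst p}"
    by (auto simp: triangle_domain_def)
  moreover have "closed {p :: real \<times> real. snd p \<le> fst p}"
    by (intro closed_Collect_le continuous_intros)
  ultimately show ?thesis by (metis compact_Times compact_Icc compact_Int_closed)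
qed

lemma triangle_domainD:
  assumes "p \<in> triangle_domain"
  shows "fst p \<in> {0..1}" "snd p \<in> {0..1}" "snd p \<le> fst p"
  using assms by (auto simp: triangle_domain_def)

lemma characteristicD:
  assumes "characteristic a b s \<gamma>"
  shows "0 \<le> s"
    and "t \<in> {0..s} \<Longrightarrow> \<gamma> t \<in> triangle_domain"
    and "t \<in> {0..s} \<Longrightarrow> ((\<lambda>t. fst (\<gamma> t)) has_real_derivative a (fst (\<gamma> t))) (at t within {0..s})"
    and "t \<in> {0..s} \<Longrightarrow> ((\<lambda>t. snd (\<gamma> t)) has_real_derivative b (snd (\<gamma> t))) (at t within {0..s})"
proof -
  show "0 \<le> s" "t \<in> {0..s} \<Longrightarrow> \<gamma> t \<in> triangle_domain"
    using assms by (auto simp: characteristic_def)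
  have d: "(\<gamma> has_vector_derivative (a (fst (\<gamma> t)), b (snd (\<gamma> t)))) (at t within {0..s})" if "t \<in> {0..s}"
    using assms that by (auto simp: characteristic_def)
  show "t \<in> {0..s} \<Longrightarrow> ((\<lambda>t. fst (\<gamma> t)) has_real_derivative a (fst (\<gamma> t))) (at t within {0..s})"
    using bounded_linear.has_vector_derivative[OF bounded_linear_fst d]
    by (simp add: has_real_derivative_iff_has_vector_derivative)
  show "t \<in> {0..s} \<Longrightarrow> ((\<lambda>t. snd (\<gamma> t)) has_real_derivative b (snd (\<gamma> t))) (at t within {0..s})"
    using bounded_linear.has_vector_derivative[OF bounded_linear_snd d]
    by (simp add: has_real_derivative_iff_has_vector_derivative)
qed

lemma characteristicI:
  assumes "0 \<le> s"
    and "\<And>t. t \<in> {0..s} \<Longrightarrow> (u t, v t) \<in> triangle_domain"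
    and "\<And>t. t \<in> {0..s} \<Longrightarrow> (u has_real_derivative a (u t)) (at t within {0..s})"
    and "\<And>t. t \<in> {0..s} \<Longrightarrow> (v has_real_derivative b (v t)) (at t within {0..s})"
  shows "characteristic a b s (\<lambda>t. (u t, v t))"
  using assms
  by (auto simp: characteristic_def has_real_derivative_iff_has_vector_derivative
      intro!: has_vector_derivative_Pair)

text \<open>Collects what the analysis needs to know about one family of characteristics, so that
  curves from the bottom and from the diagonal are treated alike afterwards. The curve
  \<open>X p\<close> runs from \<open>B\<close> to \<open>p\<close> in time \<open>s p\<close>.
  Continuity is asked for at all real times, even where a curve may have left the triangle, so that
  compositions carry no side condition on time.\<close>

locale characteristic_foliation =
  fixes a b :: "real \<Rightarrow> real" and B :: "(real \<times> real) set"
    and s :: "real \<times> real \<Rightarrow> real" and X :: "real \<times> real \<Rightarrow> real \<Rightarrow> real \<times> real"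
  assumes continuous_time: "continuous_on triangle_domain s"
    and continuous_curves: "continuous_on (triangle_domain \<times> UNIV) (\<lambda>(p, t). X p t)"
    and curve: "\<And>p. p \<in> triangle_domain \<Longrightarrow> characteristic a b (s p) (X p)"
    and start: "\<And>p. p \<in> triangle_domain \<Longrightarrow> X p 0 \<in> B"
    and stop: "\<And>p. p \<in> triangle_domain \<Longrightarrow> X p (s p) = p"
    and unique: "\<And>\<sigma> \<gamma> t. characteristic a b \<sigma> \<gamma> \<Longrightarrow> \<gamma> 0 \<in> B \<Longrightarrow> t \<in> {0..\<sigma>} \<Longrightarrow>
        s (\<gamma> \<sigma>) = \<sigma> \<and> X (\<gamma> \<sigma>) t = \<gamma> t"
begin

lemma time_nonneg: "p \<in> triangle_domain \<Longrightarrow> 0 \<le> s p"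
  using curve by (rule characteristicD)

lemma curve_in_triangle: "p \<in> triangle_domain \<Longrightarrow> t \<in> {0..s p} \<Longrightarrow> X p t \<in> triangle_domain"
  using curve by (rule characteristicD)

text \<open>A constant curve on the degenerate interval from \<open>0\<close> to \<open>0\<close> is
  a characteristic, since a derivative within a single point is no constraint. Uniqueness then
  identifies it with \<open>X p\<close>.\<close>

lemma edge:
  assumes "p \<in> triangle_domain" "p \<in> B"
  shows "s p = 0" "X p 0 = p"
proof -
  have "characteristic a b 0 (\<lambda>_. p)"
    using assms bounded_linear_scaleR_left
    by (simp add: characteristic_def has_vector_derivative_def has_derivative_within_singleton_iff
        del: scaleR_Pair)
  from unique[OF this] show "s p = 0" "X p 0 = p" using assms by auto
qed

lemma continuous_on_curve:
  assumes "p \<in> triangle_domain"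
  shows "continuous_on A (X p)"
proof -
  have "continuous_on A (\<lambda>t. case (p, t) of (p, t) \<Rightarrow> X p t)"
    by (rule continuous_on_compose2[OF continuous_curves])
      (use assms in \<open>auto intro!: continuous_intros\<close>)
  then show ?thesis by simp
qed

lemma continuous_on_start: "continuous_on triangle_domain (\<lambda>p. X p 0)"
proof -
  have "continuous_on triangle_domain (\<lambda>p. case (p, 0) of (p, t) \<Rightarrow> X p t)"
    by (rule continuous_on_compose2[OF continuous_curves]) (auto intro!: continuous_intros)
  then show ?thesis by simp
qed

lemma start_in_triangle: "p \<in> triangle_domain \<Longrightarrow> X p 0 \<in> triangle_domain"
  using curve_in_triangle[of p 0] time_nonneg by simp

lemma continuous_along_curve:
  fixes r :: "real \<times> real \<Rightarrow> real"
  assumes "continuous_on triangle_domain r" "p \<in> triangle_domain"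
  shows "continuous_on {0..s p} (\<lambda>t. r (X p t))"
  by (rule continuous_on_compose2[OF assms(1) continuous_on_curve[OF assms(2)]])
    (use curve_in_triangle[OF assms(2)] in blast)

text \<open>By \<open>unique\<close>, each characteristic from \<open>B\<close> agrees with the
  chosen curve to its end point, so quantifying over curves amounts to quantifying over end
  points.\<close>

lemma transport_eq_iff:
  "transport_eq a b B f r \<longleftrightarrow>
    (\<forall>p\<in>triangle_domain. ((\<lambda>t. r (X p t)) has_integral (f p - f (X p 0))) {0..s p})"
proof
  assume "transport_eq a b B f r"
  then show "\<forall>p\<in>triangle_domain. ((\<lambda>t. r (X p t)) has_integral (f p - f (X p 0))) {0..s p}"
    using curve start stop unfolding transport_eq_def by metis
next
  assume R: "\<forall>p\<in>triangle_domain. ((\<lambda>t. r (X p t)) has_integral (f p - f (X p 0))) {0..s p}"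
  show "transport_eq a b B f r"
    unfolding transport_eq_def
  proof (intro allI impI, elim conjE)
    fix \<sigma> \<gamma> assume c: "characteristic a b \<sigma> \<gamma>" "\<gamma> 0 \<in> B"
    have \<sigma>: "0 \<le> \<sigma>" and mem: "\<gamma> \<sigma> \<in> triangle_domain"
      using characteristicD(1,2)[OF c(1)] by auto
    have "s (\<gamma> \<sigma>) = \<sigma>" "X (\<gamma> \<sigma>) 0 = \<gamma> 0" using unique[OF c, of 0] \<sigma> by auto
    then have "((\<lambda>t. r (X (\<gamma> \<sigma>) t)) has_integral (f (\<gamma> \<sigma>) - f (\<gamma> 0))) {0..\<sigma>}"
      using R mem by metis
    then show "((\<lambda>t. r (\<gamma> t)) has_integral (f (\<gamma> \<sigma>) - f (\<gamma> 0))) {0..\<sigma>}"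
      by (rule has_integral_eq[rotated]) (use unique[OF c] in simp)
  qed
qed

text \<open>The substitution \<open>t = s p * u\<close> fixes the interval of integration; the rest
  is continuity of an integral in a parameter.\<close>

lemma continuous_on_curve_integral:
  fixes r :: "real \<times> real \<Rightarrow> real"
  assumes r: "continuous_on triangle_domain r"
  shows "continuous_on triangle_domain (\<lambda>p. integral {0..s p} (\<lambda>t. r (X p t)))"
proof -
  have rescale: "integral {0..s p} (\<lambda>t. r (X p t)) = s p * integral {0..1} (\<lambda>u. r (X p (s p * u)))"
    if p: "p \<in> triangle_domain" for p
  proof -
    have "((\<lambda>u. s p *\<^sub>R r (X p (s p * u))) has_integral
        integral {s p * 0..s p * 1} (\<lambda>t. r (X p t))) {0..1}"
      using time_nonneg[OF p]
      by (intro has_integral_substitution[where c = 0 and d = "s p"] continuous_along_curve[OF r p])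
        (auto intro!: derivative_eq_intros simp: mult_left_le)
    from integral_unique[OF this] show ?thesis by simp
  qed
  have "continuous_on (triangle_domain \<times> cbox 0 1) (\<lambda>(p, u). r (X p (s p * u)))"
    unfolding split_beta
  proof (rule continuous_on_compose2[OF r])
    show "continuous_on (triangle_domain \<times> cbox 0 1) (\<lambda>q. X (fst q) (s (fst q) * snd q))"
    proof -
      have "continuous_on (triangle_domain \<times> cbox 0 1)
          (\<lambda>q. case (fst q, s (fst q) * snd q) of (p, t) \<Rightarrow> X p t)"
        by (rule continuous_on_compose2[OF continuous_curves])
          (auto intro!: continuous_intros continuous_on_compose2[OF continuous_time])
      then show ?thesis by simp
    qed
    show "(\<lambda>q. X (fst q) (s (fst q) * snd q)) ` (triangle_domain \<times> cbox 0 1) \<subseteq> triangle_domain"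
      using time_nonneg curve_in_triangle by (auto simp: mult_left_le)
  qed
  from integral_continuous_on_param[OF this]
  have "continuous_on triangle_domain (\<lambda>p. s p * integral {0..1} (\<lambda>u. r (X p (s p * u))))"
    using continuous_time by (auto intro!: continuous_intros)
  then show ?thesis using rescale by (simp cong: continuous_on_cong)
qed

text \<open>The mean value theorem for the first coordinate between the times \<open>t\<close> and
  \<open>s p\<close>.\<close>

lemma fst_curve_le:
  assumes m: "\<And>x. x \<in> {0..1} \<Longrightarrow> m \<le> a x" and p: "p \<in> triangle_domain" and t: "t \<in> {0..s p}"
  shows "fst (X p t) \<le> fst p - m * (s p - t)"
proof -
  let ?u = "\<lambda>t. fst (X p t)"
  have "\<exists>z\<in>{t..s p}. ?u (s p) - ?u t = a (?u z) * (s p - t)"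
  proof (rule mvt_very_simple)
    fix z assume "t \<le> z" "z \<le> s p"
    then show "(?u has_derivative (*) (a (?u z))) (at z within {t..s p})"
      using characteristicD(3)[OF curve[OF p], of z] t
      by (auto simp: has_field_derivative_def intro: has_derivative_subset)
  qed (use t in auto)
  then obtain z where z: "z \<in> {t..s p}" "?u (s p) - ?u t = a (?u z) * (s p - t)" by blast
  have "X p z \<in> triangle_domain" using curve_in_triangle[OF p] z t by auto
  then have "m * (s p - t) \<le> a (?u z) * (s p - t)"
    using m triangle_domainD(1) t by (intro mult_right_mono) auto
  then show ?thesis using z stop[OF p] by simp
qed

text \<open>
  Characteristics move to the right with speed at least \<open>m\<close>, so integrating along them gains a
  factor \<open>1 / (l * m)\<close> for functions of size \<open>exp (l * x)\<close>.
\<close>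

lemma curve_integral_bound:
  assumes m: "0 < m" "\<And>x. x \<in> {0..1} \<Longrightarrow> m \<le> a x" and l: "0 < l" and K: "0 \<le> K"
    and r: "continuous_on triangle_domain r"
    and bound: "\<And>p. p \<in> triangle_domain \<Longrightarrow> \<bar>r p\<bar> \<le> K * exp (l * fst p)"
    and p: "p \<in> triangle_domain"
  shows "\<bar>integral {0..s p} (\<lambda>t. r (X p t))\<bar> \<le> K / (l * m) * exp (l * fst p)"
proof -
  \<comment> \<open>By \<open>fst_curve_le\<close>, \<open>?e\<close> dominates the integrand. Its
    antiderivative \<open>?E\<close> supplies the factor \<open>1 / (l * m)\<close>, and the
    nonnegative value \<open>?E 0\<close> is dropped.\<close>
  let ?e = "\<lambda>t. K * exp (l * (fst p - m * (s p - t)))"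
  let ?E = "\<lambda>t. K / (l * m) * exp (l * (fst p - m * (s p - t)))"
  have I: "(?e has_integral (?E (s p) - ?E 0)) {0..s p}"
    using time_nonneg[OF p] m l
    by (intro fundamental_theorem_of_calculus)
      (auto intro!: derivative_eq_intros simp: has_real_derivative_iff_has_vector_derivative[symmetric])
  have "norm (integral {0..s p} (\<lambda>t. r (X p t))) \<le> integral {0..s p} ?e"
  proof (rule integral_norm_bound_integral)
    show "(\<lambda>t. r (X p t)) integrable_on {0..s p}"
      by (intro integrable_continuous_real continuous_along_curve r p)
    show "?e integrable_on {0..s p}" using I by blast
    fix t assume t: "t \<in> {0..s p}"
    have "\<bar>r (X p t)\<bar> \<le> K * exp (l * fst (X p t))"
      by (intro bound curve_in_triangle p t)
    also have "\<dots> \<le> ?e t"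
      using fst_curve_le[OF m(2) p t] l K by (intro mult_left_mono) auto
    finally show "norm (r (X p t)) \<le> ?e t" by simp
  qed
  also have "\<dots> = ?E (s p) - ?E 0" using I by (rule integral_unique)
  also have "\<dots> \<le> ?E (s p)" using m l K by simp
  finally show ?thesis by simp
qed

end

text \<open>
  In the next two proofs \<open>X\<close> is written with explicit factors \<open>\<plusminus>1\<close> and summands \<open>0\<close> so that
  \<open>solution_of_travel_time\<close> applies by unification.
\<close>

lemma bottom_foliation:
  fixes a :: "real \<Rightarrow> real"
  assumes a: "continuous_on {0..1} a" and pos: "\<And>x. x \<in> {0..1} \<Longrightarrow> 0 < a x"
  shows "\<exists>s X. characteristic_foliation a a bottom_edge s X"
proof -
  obtain \<phi> c where c: "0 < c" and \<phi>: "continuous_on UNIV \<phi>" "\<phi> 0 = 0"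
    "\<And>x y. x \<le> y \<Longrightarrow> c * (y - x) \<le> \<phi> y - \<phi> x"
    "\<And>x. x \<in> {0..1} \<Longrightarrow> (\<phi> has_real_derivative 1 / a x) (at x)"
    using travel_time[OF a pos] by metis
  obtain \<psi> where \<psi>: "continuous_on UNIV \<psi>" "strict_mono \<psi>" "\<And>x. \<psi> (\<phi> x) = x" "\<And>t. \<phi> (\<psi> t) = t"
    using expanding_homeomorphism[OF \<phi>(1) c \<phi>(3)] by metis
  have \<psi>0: "\<psi> 0 = 0" using \<psi>(3)[of 0] \<phi>(2) by simp
  have le: "\<psi> u \<le> \<psi> t \<longleftrightarrow> u \<le> t" for u t using \<psi>(2) by (rule strict_mono_less_eq)
  have \<psi>le: "\<psi> t \<le> x \<longleftrightarrow> t \<le> \<phi> x" "x \<le> \<psi> t \<longleftrightarrow> \<phi> x \<le> t" for t x using le \<psi>(3) by metis+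
  have \<phi>le: "\<phi> x \<le> \<phi> y \<longleftrightarrow> x \<le> y" for x y using \<psi>le \<psi>(3) by metis
  \<comment> \<open>Both travel times grow at unit speed, so their difference is constant along a
    characteristic. At the start the second one is \<open>\<phi> 0 = 0\<close>; hence the elapsed
    time is \<open>\<phi> (snd p)\<close> and the first one starts at
    \<open>\<phi> (fst p) - \<phi> (snd p)\<close>.\<close>
  define s where "s p = \<phi> (snd p)" for p :: "real \<times> real"
  define X where "X p t = (\<psi> (\<phi> (fst p) - \<phi> (snd p) + 1 * t), \<psi> (0 + 1 * t))" for p :: "real \<times> real" and t
  have "characteristic_foliation a a bottom_edge s X"
  proof
    show "continuous_on triangle_domain s"
      unfolding s_def by (intro continuous_on_compose2[OF \<phi>(1)] continuous_intros) auto
    show "continuous_on (triangle_domain \<times> UNIV) (\<lambda>(p, t). X p t)"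
      unfolding X_def split_beta
      by (intro continuous_intros continuous_on_compose2[OF \<phi>(1)] continuous_on_compose2[OF \<psi>(1)]) auto
    fix p :: "real \<times> real" assume p: "p \<in> triangle_domain"
    note D = triangle_domainD[OF p]
    have X_in: "X p t \<in> triangle_domain" if "t \<in> {0..s p}" for t
    proof -
      have "\<psi> t \<le> \<psi> (\<phi> (fst p) - \<phi> (snd p) + t)" using D \<phi>le by (simp add: le)
      moreover have "\<psi> (\<phi> (fst p) - \<phi> (snd p) + t) \<le> fst p" using that \<psi>le by (simp add: s_def)
      moreover have "0 \<le> \<psi> t" using that le[of 0 t] \<psi>0 by simp
      ultimately show ?thesis using D by (simp add: triangle_domain_def X_def)
    qed
    show "characteristic a a (s p) (X p)"
      unfolding X_def
    proof (rule characteristicI)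
      show "0 \<le> s p" using D \<phi>le[of 0 "snd p"] \<phi>(2) by (simp add: s_def)
      fix t assume t: "t \<in> {0..s p}"
      show "(\<psi> (\<phi> (fst p) - \<phi> (snd p) + 1 * t), \<psi> (0 + 1 * t)) \<in> triangle_domain"
        using X_in[OF t] by (simp add: X_def)
      have mem: "\<psi> (\<phi> (fst p) - \<phi> (snd p) + 1 * t) \<in> {0..1}" "\<psi> (0 + 1 * t) \<in> {0..1}"
        using triangle_domainD[OF X_in[OF t]] by (simp_all add: X_def)
      show "((\<lambda>t. \<psi> (\<phi> (fst p) - \<phi> (snd p) + 1 * t)) has_real_derivative
          a (\<psi> (\<phi> (fst p) - \<phi> (snd p) + 1 * t))) (at t within {0..s p})"
        using solution_of_travel_time[OF \<phi>(4) pos \<psi>(1,4) mem(1)] by simp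
      show "((\<lambda>t. \<psi> (0 + 1 * t)) has_real_derivative a (\<psi> (0 + 1 * t))) (at t within {0..s p})"
        using solution_of_travel_time[OF \<phi>(4) pos \<psi>(1,4) mem(2)] by simp
    qed
    show "X p (s p) = p" by (simp add: X_def s_def \<psi>(3))
    have "0 \<le> s p" using D \<phi>le[of 0 "snd p"] \<phi>(2) by (simp add: s_def)
    then have "fst (X p 0) \<in> {0..1}" using X_in[of 0] by (intro triangle_domainD) simp
    then show "X p 0 \<in> bottom_edge" by (simp add: X_def bottom_edge_def \<psi>0)
  next
    fix \<sigma> \<gamma> t
    assume c: "characteristic a a \<sigma> \<gamma>" and B: "\<gamma> 0 \<in> bottom_edge" and t: "t \<in> {0..\<sigma>}"
    note D = characteristicD[OF c]
    \<comment> \<open>In travel time the given curve is a line of unit speed; its values at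
      \<open>t\<close> and at the end point \<open>\<sigma>\<close> then determine everything in the
      definitions of \<open>s\<close> and \<open>X\<close>.\<close>
    have fst: "\<phi> (fst (\<gamma> t)) = \<phi> (fst (\<gamma> 0)) + 1 * t" if "t \<in> {0..\<sigma>}" for t
      using D by (intro travel_time_along_solution[OF \<phi>(4) pos _ that]) (simp_all add: triangle_domainD del: atLeastAtMost_iff)
    have snd: "\<phi> (snd (\<gamma> t)) = \<phi> (snd (\<gamma> 0)) + 1 * t" if "t \<in> {0..\<sigma>}" for t
      using D by (intro travel_time_along_solution[OF \<phi>(4) pos _ that]) (simp_all add: triangle_domainD del: atLeastAtMost_iff)
    have s0: "\<phi> (snd (\<gamma> 0)) = 0" using B \<phi>(2) by (auto simp: bottom_edge_def)
    have "X (\<gamma> \<sigma>) t = \<gamma> t"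
    proof (rule prod_eqI)
      show "fst (X (\<gamma> \<sigma>) t) = fst (\<gamma> t)"
        using fst[OF t] fst[of \<sigma>] snd[of \<sigma>] s0 D(1) \<psi>(3)[of "fst (\<gamma> t)"] by (simp add: X_def)
      show "snd (X (\<gamma> \<sigma>) t) = snd (\<gamma> t)"
        using snd[OF t] s0 \<psi>(3)[of "snd (\<gamma> t)"] by (simp add: X_def)
    qed
    then show "s (\<gamma> \<sigma>) = \<sigma> \<and> X (\<gamma> \<sigma>) t = \<gamma> t"
      using snd[of \<sigma>] s0 D(1) by (simp add: s_def)
  qed
  then show ?thesis by blast
qed

lemma diagonal_foliation:
  fixes a b :: "real \<Rightarrow> real"
  assumes a: "continuous_on {0..1} a" and apos: "\<And>x. x \<in> {0..1} \<Longrightarrow> 0 < a x"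
    and b: "continuous_on {0..1} b" and bpos: "\<And>x. x \<in> {0..1} \<Longrightarrow> 0 < b x"
  shows "\<exists>s X. characteristic_foliation a (\<lambda>\<xi>. - b \<xi>) diagonal_edge s X"
proof -
  obtain \<phi> c where c: "0 < c" and \<phi>: "continuous_on UNIV \<phi>"
    "\<And>x y. x \<le> y \<Longrightarrow> c * (y - x) \<le> \<phi> y - \<phi> x"
    "\<And>x. x \<in> {0..1} \<Longrightarrow> (\<phi> has_real_derivative 1 / a x) (at x)"
    using travel_time[OF a apos] by metis
  obtain \<psi> where \<psi>: "continuous_on UNIV \<psi>" "strict_mono \<psi>" "\<And>x. \<psi> (\<phi> x) = x" "\<And>t. \<phi> (\<psi> t) = t"
    using expanding_homeomorphism[OF \<phi>(1) c \<phi>(2)] by metis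
  obtain \<phi>' c' where c': "0 < c'" and \<phi>': "continuous_on UNIV \<phi>'"
    "\<And>x y. x \<le> y \<Longrightarrow> c' * (y - x) \<le> \<phi>' y - \<phi>' x"
    "\<And>x. x \<in> {0..1} \<Longrightarrow> (\<phi>' has_real_derivative 1 / b x) (at x)"
    using travel_time[OF b bpos] by metis
  obtain \<psi>' where \<psi>': "continuous_on UNIV \<psi>'" "strict_mono \<psi>'" "\<And>x. \<psi>' (\<phi>' x) = x" "\<And>t. \<phi>' (\<psi>' t) = t"
    using expanding_homeomorphism[OF \<phi>'(1) c' \<phi>'(2)] by metis
  have sum: "continuous_on UNIV (\<lambda>x. \<phi> x + \<phi>' x)" by (intro continuous_intros \<phi> \<phi>')
  \<comment> \<open>The travel time of the first coordinate grows at unit speed while that of the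
    second falls, so \<open>\<phi> x + \<phi>' \<xi>\<close> is constant along a characteristic.
    Inverting \<open>\<phi> + \<phi>'\<close> therefore recovers the starting point on the
    diagonal.\<close>
  obtain \<theta> where \<theta>: "continuous_on UNIV \<theta>" "strict_mono \<theta>"
    "\<And>x. \<theta> (\<phi> x + \<phi>' x) = x" "\<And>t. \<phi> (\<theta> t) + \<phi>' (\<theta> t) = t"
  proof (rule expanding_homeomorphism[OF sum add_pos_pos[OF c c']])
    show "(c + c') * (y - x) \<le> (\<phi> y + \<phi>' y) - (\<phi> x + \<phi>' x)" if "x \<le> y" for x y
      using \<phi>(2)[OF that] \<phi>'(2)[OF that] by (simp add: distrib_right)
  qed (rule that)
  have \<psi>le: "\<psi> t \<le> x \<longleftrightarrow> t \<le> \<phi> x" "x \<le> \<psi> t \<longleftrightarrow> \<phi> x \<le> t" for t x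
    using strict_mono_less_eq[OF \<psi>(2)] \<psi>(3) by metis+
  have \<psi>le': "\<psi>' t \<le> x \<longleftrightarrow> t \<le> \<phi>' x" "x \<le> \<psi>' t \<longleftrightarrow> \<phi>' x \<le> t" for t x
    using strict_mono_less_eq[OF \<psi>'(2)] \<psi>'(3) by metis+
  have \<theta>le: "\<theta> t \<le> x \<longleftrightarrow> t \<le> \<phi> x + \<phi>' x" "x \<le> \<theta> t \<longleftrightarrow> \<phi> x + \<phi>' x \<le> t" for t x
    using strict_mono_less_eq[OF \<theta>(2)] \<theta>(3) by metis+
  have \<phi>le: "\<phi> x \<le> \<phi> y \<longleftrightarrow> x \<le> y" for x y using \<psi>le \<psi>(3) by metis
  have \<phi>le': "\<phi>' x \<le> \<phi>' y \<longleftrightarrow> x \<le> y" for x y using \<psi>le' \<psi>'(3) by metis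
  \<comment> \<open>The characteristic through \<open>p\<close> starts at \<open>(y p, y p)\<close>,
    and \<open>s p\<close> is the time its first coordinate takes from \<open>y p\<close> to
    \<open>fst p\<close>.\<close>
  define y where "y p = \<theta> (\<phi> (fst p) + \<phi>' (snd p))" for p :: "real \<times> real"
  define s where "s p = \<phi> (fst p) - \<phi> (y p)" for p :: "real \<times> real"
  define X where "X p t = (\<psi> (\<phi> (y p) + 1 * t), \<psi>' (\<phi>' (y p) + (- 1) * t))" for p :: "real \<times> real" and t
  have y_cont: "continuous_on A y" for A
    unfolding y_def
    by (intro continuous_on_compose2[OF \<theta>(1)] continuous_intros
        continuous_on_compose2[OF \<phi>(1)] continuous_on_compose2[OF \<phi>'(1)]) auto
  have y_eq: "\<phi> (y p) + \<phi>' (y p) = \<phi> (fst p) + \<phi>' (snd p)" for p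
    unfolding y_def by (rule \<theta>(4))
  have "characteristic_foliation a (\<lambda>\<xi>. - b \<xi>) diagonal_edge s X"
  proof
    show "continuous_on triangle_domain s"
      unfolding s_def
      by (intro continuous_intros continuous_on_compose2[OF \<phi>(1)] y_cont) auto
    show "continuous_on (triangle_domain \<times> UNIV) (\<lambda>(p, t). X p t)"
      unfolding X_def split_beta
      by (intro continuous_intros continuous_on_compose2[OF \<phi>(1)] continuous_on_compose2[OF \<psi>(1)]
          continuous_on_compose2[OF \<phi>'(1)] continuous_on_compose2[OF \<psi>'(1)]
          continuous_on_compose2[OF y_cont]) auto
    fix p :: "real \<times> real" assume p: "p \<in> triangle_domain"
    note D = triangle_domainD[OF p]
    \<comment> \<open>The value of \<open>\<phi> + \<phi>'\<close> at \<open>y p\<close> lies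
      between its values at \<open>snd p\<close> and \<open>fst p\<close>.\<close>
    have y: "snd p \<le> y p" "y p \<le> fst p"
      using D \<phi>le \<phi>le' unfolding y_def \<theta>le by simp_all
    have s: "0 \<le> s p" using y \<phi>le by (simp add: s_def)
    have X_in: "X p t \<in> triangle_domain" if "t \<in> {0..s p}" for t
    proof -
      have "y p \<le> \<psi> (\<phi> (y p) + t)" "\<psi> (\<phi> (y p) + t) \<le> fst p"
        using that \<psi>le by (simp_all add: s_def)
      moreover have "\<psi>' (\<phi>' (y p) - t) \<le> y p" "snd p \<le> \<psi>' (\<phi>' (y p) - t)"
        using that \<psi>le' y_eq[of p] by (simp_all add: s_def)
      ultimately show ?thesis using D by (simp add: triangle_domain_def X_def)
    qed
    show "characteristic a (\<lambda>\<xi>. - b \<xi>) (s p) (X p)"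
      unfolding X_def
    proof (rule characteristicI)
      fix t assume t: "t \<in> {0..s p}"
      show "(\<psi> (\<phi> (y p) + 1 * t), \<psi>' (\<phi>' (y p) + (- 1) * t)) \<in> triangle_domain"
        using X_in[OF t] by (simp add: X_def)
      have mem: "\<psi> (\<phi> (y p) + 1 * t) \<in> {0..1}" "\<psi>' (\<phi>' (y p) + (- 1) * t) \<in> {0..1}"
        using triangle_domainD[OF X_in[OF t]] by (simp_all add: X_def)
      show "((\<lambda>t. \<psi> (\<phi> (y p) + 1 * t)) has_real_derivative a (\<psi> (\<phi> (y p) + 1 * t))) (at t within {0..s p})"
        using solution_of_travel_time[OF \<phi>(3) apos \<psi>(1,4) mem(1)] by simp
      show "((\<lambda>t. \<psi>' (\<phi>' (y p) + (- 1) * t)) has_real_derivative - b (\<psi>' (\<phi>' (y p) + (- 1) * t))) (at t within {0..s p})"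
        using solution_of_travel_time[OF \<phi>'(3) bpos \<psi>'(1,4) mem(2)] by simp
    qed (fact s)
    show "X p (s p) = p"
    proof -
      have "\<phi> (y p) + s p = \<phi> (fst p)" "\<phi>' (y p) - s p = \<phi>' (snd p)"
        using y_eq[of p] by (simp_all add: s_def)
      then show ?thesis by (simp add: X_def \<psi>(3) \<psi>'(3))
    qed
    show "X p 0 \<in> diagonal_edge"
      using y D by (simp add: X_def diagonal_edge_def \<psi>(3) \<psi>'(3))
  next
    fix \<sigma> \<gamma> t
    assume c: "characteristic a (\<lambda>\<xi>. - b \<xi>) \<sigma> \<gamma>" and B: "\<gamma> 0 \<in> diagonal_edge" and t: "t \<in> {0..\<sigma>}"
    note D = characteristicD[OF c]
    have fst: "\<phi> (fst (\<gamma> t)) = \<phi> (fst (\<gamma> 0)) + 1 * t" if "t \<in> {0..\<sigma>}" for t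
      using D by (intro travel_time_along_solution[OF \<phi>(3) apos _ that]) (simp_all add: triangle_domainD del: atLeastAtMost_iff)
    have snd: "\<phi>' (snd (\<gamma> t)) = \<phi>' (snd (\<gamma> 0)) + (- 1) * t" if "t \<in> {0..\<sigma>}" for t
      using D by (intro travel_time_along_solution[OF \<phi>'(3) bpos _ that]) (simp_all add: triangle_domainD del: atLeastAtMost_iff)
    have s0: "snd (\<gamma> 0) = fst (\<gamma> 0)" using B by (auto simp: diagonal_edge_def)
    have y0: "y (\<gamma> \<sigma>) = fst (\<gamma> 0)"
      using fst[of \<sigma>] snd[of \<sigma>] s0 D(1) \<theta>(3)[of "fst (\<gamma> 0)"] by (simp add: y_def)
    have "X (\<gamma> \<sigma>) t = \<gamma> t"
    proof (rule prod_eqI)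
      show "fst (X (\<gamma> \<sigma>) t) = fst (\<gamma> t)"
        using fst[OF t] \<psi>(3)[of "fst (\<gamma> t)"] by (simp add: X_def y0)
      show "snd (X (\<gamma> \<sigma>) t) = snd (\<gamma> t)"
        using snd[OF t] s0 \<psi>'(3)[of "snd (\<gamma> t)"] by (simp add: X_def y0)
    qed
    then show "s (\<gamma> \<sigma>) = \<sigma> \<and> X (\<gamma> \<sigma>) t = \<gamma> t"
      using fst[of \<sigma>] y0 D(1) by (simp add: s_def)
  qed
  then show ?thesis by blast
qed

section \<open>The fixed point equation\<close>

text \<open>
  The four boundary conditions have the common form \<open>F\<^sub>j = h\<^sub>j + \<alpha>\<^sub>j F\<^sub>2(x, 0) + \<beta>\<^sub>j F\<^sub>3(x, 0)\<close> on \<open>B\<^sub>j\<close>,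
  with vanishing coefficients for \<open>j = 2, 3\<close>.
\<close>

locale characteristic_system =
  fixes a b :: "nat \<Rightarrow> real \<Rightarrow> real" and B :: "nat \<Rightarrow> (real \<times> real) set"
    and s :: "nat \<Rightarrow> real \<times> real \<Rightarrow> real" and X :: "nat \<Rightarrow> real \<times> real \<Rightarrow> real \<Rightarrow> real \<times> real"
    and h \<alpha> \<beta> :: "nat \<Rightarrow> real \<Rightarrow> real"
    and g :: "nat \<Rightarrow> real \<times> real \<Rightarrow> real" and C :: "nat \<Rightarrow> nat \<Rightarrow> real \<times> real \<Rightarrow> real"
    and m :: real
  assumes foliation: "\<And>j. j \<in> {1..4} \<Longrightarrow> characteristic_foliation (a j) (b j) (B j) (s j) (X j)"
    and m_pos: "0 < m"
    and m_le: "\<And>j x. j \<in> {1..4} \<Longrightarrow> x \<in> {0..1} \<Longrightarrow> m \<le> a j x"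
    and continuous_h: "\<And>j. j \<in> {1..4} \<Longrightarrow> continuous_on {0..1} (h j)"
    and continuous_\<alpha>: "\<And>j. j \<in> {1..4} \<Longrightarrow> continuous_on {0..1} (\<alpha> j)"
    and continuous_\<beta>: "\<And>j. j \<in> {1..4} \<Longrightarrow> continuous_on {0..1} (\<beta> j)"
    and continuous_g: "\<And>j. j \<in> {1..4} \<Longrightarrow> continuous_on triangle_domain (g j)"
    and continuous_C: "\<And>j i. j \<in> {1..4} \<Longrightarrow> i \<in> {1..4} \<Longrightarrow> continuous_on triangle_domain (C j i)"
    and no_reflection: "\<And>j x. j \<in> {2, 3} \<Longrightarrow> \<alpha> j x = 0" "\<And>j x. j \<in> {2, 3} \<Longrightarrow> \<beta> j x = 0"
begin

text \<open>The counterpart of \<open>hyperbolic_solution\<close> that is uniform in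
  \<open>j\<close>, so that all four components share one argument.\<close>

definition solution :: "(nat \<Rightarrow> real \<times> real \<Rightarrow> real) \<Rightarrow> bool" where
  "solution F \<longleftrightarrow>
     (\<forall>j\<in>{1..4}. continuous_on triangle_domain (F j)) \<and>
     (\<forall>j\<in>{1..4}. transport_eq (a j) (b j) (B j) (F j) (source g C F j)) \<and>
     (\<forall>j\<in>{1..4}. \<forall>p\<in>triangle_domain \<inter> B j.
        F j p = h j (fst p) + \<alpha> j (fst p) * F 2 (fst p, 0) + \<beta> j (fst p) * F 3 (fst p, 0))"

text \<open>The integral formula for \<open>F j\<close> with the reflection terms of the boundary
  condition left out.\<close>

definition transported :: "(nat \<Rightarrow> real \<times> real \<Rightarrow> real) \<Rightarrow> nat \<Rightarrow> real \<times> real \<Rightarrow> real" where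
  "transported F j p =
     h j (fst (X j p 0)) + integral {0..s j p} (\<lambda>t. source g C F j (X j p t))"

text \<open>The reflected values of \<open>F 2\<close> and \<open>F 3\<close> on the bottom are
  replaced by their integral formulas. With the values themselves, large \<open>\<alpha>\<close> and
  \<open>\<beta>\<close> could prevent a contraction; the integrals gain a small factor for large
  \<open>l\<close>.\<close>

definition picard :: "(nat \<Rightarrow> real \<times> real \<Rightarrow> real) \<Rightarrow> nat \<Rightarrow> real \<times> real \<Rightarrow> real" where
  "picard F j p =
     transported F j p + \<alpha> j (fst (X j p 0)) * transported F 2 (fst (X j p 0), 0)
       + \<beta> j (fst (X j p 0)) * transported F 3 (fst (X j p 0), 0)"

lemma picard_23: "j \<in> {2, 3} \<Longrightarrow> picard F j p = transported F j p"
  using no_reflection by (simp add: picard_def)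

lemma continuous_on_source:
  assumes "\<And>i. i \<in> {1..4} \<Longrightarrow> continuous_on triangle_domain (F i)" "j \<in> {1..4}"
  shows "continuous_on triangle_domain (source g C F j)"
  using assms continuous_g continuous_C unfolding source_def by (intro continuous_intros) auto

lemma start_fst:
  assumes "j \<in> {1..4}" "p \<in> triangle_domain"
  shows "fst (X j p 0) \<in> {0..1}"
  using characteristic_foliation.start_in_triangle[OF foliation] assms by (intro triangle_domainD) auto

lemma bottom_in_triangle: "x \<in> {0..1} \<Longrightarrow> (x, 0) \<in> triangle_domain"
  by (simp add: triangle_domain_def)

lemma continuous_on_start_fst:
  "j \<in> {1..4} \<Longrightarrow> continuous_on triangle_domain (\<lambda>p. fst (X j p 0))"
  using characteristic_foliation.continuous_on_start[OF foliation] by (intro continuous_intros) auto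

lemma continuous_on_transported:
  assumes "\<And>i. i \<in> {1..4} \<Longrightarrow> continuous_on triangle_domain (F i)" "j \<in> {1..4}"
  shows "continuous_on triangle_domain (transported F j)"
  unfolding transported_def
proof (intro continuous_on_add)
  show "continuous_on triangle_domain (\<lambda>p. h j (fst (X j p 0)))"
    by (rule continuous_on_compose2[OF continuous_h continuous_on_start_fst])
      (use assms start_fst in blast)+
  show "continuous_on triangle_domain (\<lambda>p. integral {0..s j p} (\<lambda>t. source g C F j (X j p t)))"
    using assms by (intro characteristic_foliation.continuous_on_curve_integral[OF foliation] continuous_on_source)
qed

lemma continuous_on_picard:
  assumes F: "\<And>i. i \<in> {1..4} \<Longrightarrow> continuous_on triangle_domain (F i)" and j: "j \<in> {1..4}"
  shows "continuous_on triangle_domain (picard F j)"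
proof -
  have *: "continuous_on triangle_domain (\<lambda>p. f (fst (X j p 0)))" if "continuous_on {0..1} f" for f :: "real \<Rightarrow> real"
    by (rule continuous_on_compose2[OF that continuous_on_start_fst]) (use j start_fst in blast)+
  have "continuous_on {0..1} (\<lambda>x. transported F k (x, 0))" if "k \<in> {1..4}" for k
    by (rule continuous_on_compose2[OF continuous_on_transported[OF F that]])
      (auto intro!: continuous_intros bottom_in_triangle)
  from this[of 2] this[of 3] show ?thesis
    unfolding picard_def
    by (intro continuous_on_add continuous_on_mult * continuous_on_transported F j continuous_\<alpha> continuous_\<beta>
        *[of "\<lambda>x. transported F 2 (x, 0)"] *[of "\<lambda>x. transported F 3 (x, 0)"]) auto
qed

text \<open>Along each curve the source is continuous, hence integrable, so
  \<open>has_integral\<close> becomes an equation. The term \<open>h j\<close> is subtracted because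
  \<open>transported\<close> contains it.\<close>

lemma transport_eq_iff:
  assumes "\<And>i. i \<in> {1..4} \<Longrightarrow> continuous_on triangle_domain (F i)" and j: "j \<in> {1..4}"
  shows "transport_eq (a j) (b j) (B j) (F j) (source g C F j) \<longleftrightarrow>
    (\<forall>p\<in>triangle_domain. F j p = F j (X j p 0) - h j (fst (X j p 0)) + transported F j p)"
proof -
  have "((\<lambda>t. source g C F j (X j p t)) has_integral v) {0..s j p} \<longleftrightarrow>
      integral {0..s j p} (\<lambda>t. source g C F j (X j p t)) = v" if "p \<in> triangle_domain" for p v
    using integrable_continuous_real[OF characteristic_foliation.continuous_along_curve[OF
          foliation[OF j] continuous_on_source[of F, OF assms] that]]
    by (simp add: has_integral_iff)
  then show ?thesis
    unfolding characteristic_foliation.transport_eq_iff[OF foliation[OF j]]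
    by (intro ball_cong) (auto simp: transported_def)
qed

text \<open>Components 2 and 3 have no reflection, so on either side of the equivalence they equal
  their integral formulas. Substituting this into \<open>picard\<close> for the other components
  gives back the original boundary terms.\<close>

lemma solution_iff_picard_fixpoint:
  assumes F: "\<And>i. i \<in> {1..4} \<Longrightarrow> continuous_on triangle_domain (F i)"
  shows "solution F \<longleftrightarrow> (\<forall>j\<in>{1..4}. \<forall>p\<in>triangle_domain. picard F j p = F j p)"
proof
  assume "solution F"
  then have tr: "F j p = F j (X j p 0) - h j (fst (X j p 0)) + transported F j p"
    if "j \<in> {1..4}" "p \<in> triangle_domain" for j p
    using that transport_eq_iff[of F, OF F that(1)] unfolding solution_def by blast
  have bc: "F j p = h j (fst p) + \<alpha> j (fst p) * F 2 (fst p, 0) + \<beta> j (fst p) * F 3 (fst p, 0)"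
    if "j \<in> {1..4}" "p \<in> triangle_domain" "p \<in> B j" for j p
    using \<open>solution F\<close> that unfolding solution_def by blast
  have start: "F j (X j p 0) = h j (fst (X j p 0)) + \<alpha> j (fst (X j p 0)) * F 2 (fst (X j p 0), 0)
      + \<beta> j (fst (X j p 0)) * F 3 (fst (X j p 0), 0)" if "j \<in> {1..4}" "p \<in> triangle_domain" for j p
    using bc characteristic_foliation.start_in_triangle characteristic_foliation.start foliation that
    by metis
  have eq: "F j p = transported F j p" if "j \<in> {2, 3}" "p \<in> triangle_domain" for j p
  proof -
    have "j \<in> {1..4}" using that by auto
    then show ?thesis using tr[of j p] start[of j p] no_reflection that by simp
  qed
  show "\<forall>j\<in>{1..4}. \<forall>p\<in>triangle_domain. picard F j p = F j p"
  proof (intro ballI)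
    fix j p assume jp: "j \<in> {1..4::nat}" "p \<in> triangle_domain"
    have "(fst (X j p 0), 0) \<in> triangle_domain" by (intro bottom_in_triangle start_fst jp)
    then show "picard F j p = F j p"
      using tr[OF jp] start[OF jp] eq by (simp add: picard_def)
  qed
next
  assume fp: "\<forall>j\<in>{1..4}. \<forall>p\<in>triangle_domain. picard F j p = F j p"
  have eq: "transported F j p = F j p" if "j \<in> {2, 3}" "p \<in> triangle_domain" for j p
  proof -
    have "j \<in> {1..4}" using that by auto
    then show ?thesis using fp picard_23[OF that(1)] that(2) by metis
  qed
  have bc: "F j p = h j (fst p) + \<alpha> j (fst p) * F 2 (fst p, 0) + \<beta> j (fst p) * F 3 (fst p, 0)"
    if "j \<in> {1..4}" "p \<in> triangle_domain" "p \<in> B j" for j p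
  proof -
    \<comment> \<open>At a point of the edge the travel time is zero, so the integral vanishes and
      the fixed point equation reduces to the boundary condition.\<close>
    note e = characteristic_foliation.edge[OF foliation that(2,3)]
    have "(fst p, 0) \<in> triangle_domain" by (intro bottom_in_triangle triangle_domainD that)
    then have "picard F j p = h j (fst p) + \<alpha> j (fst p) * F 2 (fst p, 0) + \<beta> j (fst p) * F 3 (fst p, 0)"
      using that eq by (simp add: picard_def e transported_def[of F j])
    then show ?thesis using fp that by simp
  qed
  have "transport_eq (a j) (b j) (B j) (F j) (source g C F j)" if j: "j \<in> {1..4}" for j
  proof -
    have "F j p = F j (X j p 0) - h j (fst (X j p 0)) + transported F j p" if p: "p \<in> triangle_domain"
      for p
    proof -
      note X0 = characteristic_foliation.start_in_triangle[OF foliation[OF j] p]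
        characteristic_foliation.start[OF foliation[OF j] p]
      have "(fst (X j p 0), 0) \<in> triangle_domain" by (intro bottom_in_triangle start_fst j p)
      then have "picard F j p = F j (X j p 0) - h j (fst (X j p 0)) + transported F j p"
        using bc[OF j X0] eq by (simp add: picard_def)
      then show ?thesis using fp j p by simp
    qed
    then show ?thesis using transport_eq_iff[of F j] F j by blast
  qed
  then show "solution F" using F bc by (auto simp: solution_def)
qed

text \<open>The terms \<open>h j\<close> and \<open>g j\<close> cancel in the difference; the four
  coupling terms contribute \<open>4 * K * M\<close>, and integration along the curve gains
  \<open>1 / (l * m)\<close>.\<close>

lemma transported_diff_bound:
  assumes F: "\<And>i. i \<in> {1..4} \<Longrightarrow> continuous_on triangle_domain (F i)"
    and G: "\<And>i. i \<in> {1..4} \<Longrightarrow> continuous_on triangle_domain (G i)"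
    and K: "0 \<le> K" "\<And>j i p. j \<in> {1..4} \<Longrightarrow> i \<in> {1..4} \<Longrightarrow> p \<in> triangle_domain \<Longrightarrow> \<bar>C j i p\<bar> \<le> K"
    and l: "0 < l" and M: "0 \<le> M"
    and FG: "\<And>i p. i \<in> {1..4} \<Longrightarrow> p \<in> triangle_domain \<Longrightarrow> \<bar>F i p - G i p\<bar> \<le> M * exp (l * fst p)"
    and j: "j \<in> {1..4}" and p: "p \<in> triangle_domain"
  shows "\<bar>transported F j p - transported G j p\<bar> \<le> 4 * K * M / (l * m) * exp (l * fst p)"
proof -
  let ?r = "\<lambda>p. source g C F j p - source g C G j p"
  note fol = foliation[OF j]
  have cF: "continuous_on triangle_domain (source g C F j)" and cG: "continuous_on triangle_domain (source g C G j)"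
    using F G j by (blast intro: continuous_on_source)+
  have "\<bar>?r p\<bar> \<le> 4 * K * M * exp (l * fst p)" if p: "p \<in> triangle_domain" for p
  proof -
    have "?r p = (\<Sum>i=1..4. C j i p * (F i p - G i p))"
      by (simp add: source_def sum_subtractf algebra_simps)
    also have "\<bar>\<dots>\<bar> \<le> (\<Sum>i=1..4. \<bar>C j i p * (F i p - G i p)\<bar>)" by (rule sum_abs)
    also have "\<dots> \<le> (\<Sum>i=1..4::nat. K * (M * exp (l * fst p)))"
      unfolding abs_mult using K(1) by (intro sum_mono mult_mono K(2) FG j p) auto
    finally show ?thesis by (simp add: algebra_simps)
  qed
  then have "\<bar>integral {0..s j p} (\<lambda>t. ?r (X j p t))\<bar> \<le> 4 * K * M / (l * m) * exp (l * fst p)"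
    using K M l m_pos m_le[OF j] p cF cG
    by (intro characteristic_foliation.curve_integral_bound[OF fol]) (auto intro!: continuous_intros)
  moreover have "integral {0..s j p} (\<lambda>t. ?r (X j p t)) = transported F j p - transported G j p"
    unfolding transported_def
    by (subst integral_diff)
      (auto intro!: integrable_continuous_real characteristic_foliation.continuous_along_curve[OF fol] cF cG p)
  ultimately show ?thesis by simp
qed

theorem ex_unique_solution:
  obtains F where "solution F"
    and "\<And>G i p. solution G \<Longrightarrow> i \<in> {1..4} \<Longrightarrow> p \<in> triangle_domain \<Longrightarrow> G i p = F i p"
proof -
  have "bounded (\<Union>j\<in>{1..4}. \<Union>i\<in>{1..4}. C j i ` triangle_domain)"
    using continuous_C by (intro bounded_UN ballI compact_imp_bounded compact_continuous_image compact_triangle_domain) auto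
  then obtain K where K: "0 < K" "\<And>j i p. j \<in> {1..4} \<Longrightarrow> i \<in> {1..4} \<Longrightarrow> p \<in> triangle_domain \<Longrightarrow> \<bar>C j i p\<bar> \<le> K"
    unfolding bounded_pos by force
  have "bounded (\<Union>j\<in>{1..4}. \<alpha> j ` {0..1} \<union> \<beta> j ` {0..1})"
    using continuous_\<alpha> continuous_\<beta>
    by (intro bounded_UN ballI bounded_Un[THEN iffD2] conjI compact_imp_bounded compact_continuous_image) auto
  then obtain Q where Q: "0 < Q" "\<And>j x. j \<in> {1..4} \<Longrightarrow> x \<in> {0..1} \<Longrightarrow> \<bar>\<alpha> j x\<bar> \<le> Q"
    "\<And>j x. j \<in> {1..4} \<Longrightarrow> x \<in> {0..1} \<Longrightarrow> \<bar>\<beta> j x\<bar> \<le> Q"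
    unfolding bounded_pos by force
  \<comment> \<open>Chosen so that \<open>(1 + 2 * Q) * (4 * K / (l * m)) = 1 / 2\<close>: one
    direct integral and two reflected ones, each of the latter with a coefficient of size at most
    \<open>Q\<close>.\<close>
  define l where "l = 4 * K * (2 * (1 + 2 * Q)) / m"
  have l: "0 < l" using K Q m_pos by (simp add: l_def add_pos_pos)
  have contraction: "\<bar>picard F j p - picard G j p\<bar> \<le> M / 2 * exp (l * fst p)"
    if F: "\<And>i. i \<in> {1..4} \<Longrightarrow> continuous_on triangle_domain (F i)"
      and G: "\<And>i. i \<in> {1..4} \<Longrightarrow> continuous_on triangle_domain (G i)"
      and M: "0 \<le> M" and FG: "\<And>i p. i \<in> {1..4} \<Longrightarrow> p \<in> triangle_domain \<Longrightarrow> \<bar>F i p - G i p\<bar> \<le> M * exp (l * fst p)"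
      and j: "j \<in> {1..4}" and p: "p \<in> triangle_domain" for F G M j p
  proof -
    define c where "c = 4 * K * M / (l * m)"
    have c: "0 \<le> c" using K M l m_pos by (simp add: c_def)
    have T: "\<bar>transported F i p - transported G i p\<bar> \<le> c * exp (l * fst p)"
      if "i \<in> {1..4}" "p \<in> triangle_domain" for i p
      unfolding c_def using K by (intro transported_diff_bound F G l M FG that) auto
    let ?x = "fst (X j p 0)"
    have x: "?x \<in> {0..1}" by (intro start_fst j p)
    \<comment> \<open>The starting point lies to the left of \<open>p\<close>, so the weight there,
      and likewise at the bottom point below it, is at most the weight at \<open>p\<close>.\<close>
    have "?x \<le> fst p"
      using characteristic_foliation.fst_curve_le[OF foliation[OF j] m_le[OF j] p, of 0]
        characteristic_foliation.time_nonneg[OF foliation[OF j] p] m_pos by (smt (verit) atLeastAtMost_iff mult_nonneg_nonneg)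
    then have "c * exp (l * ?x) \<le> c * exp (l * fst p)" using c l by (simp add: mult_left_mono)
    then have T': "\<bar>transported F i (?x, 0) - transported G i (?x, 0)\<bar> \<le> c * exp (l * fst p)" if "i \<in> {1..4}" for i
      using T[OF that bottom_in_triangle[OF x]] by simp
    have "picard F j p - picard G j p = (transported F j p - transported G j p)
        + \<alpha> j ?x * (transported F 2 (?x, 0) - transported G 2 (?x, 0))
        + \<beta> j ?x * (transported F 3 (?x, 0) - transported G 3 (?x, 0))"
      by (simp add: picard_def algebra_simps)
    moreover have "\<bar>\<alpha> j ?x * (transported F 2 (?x, 0) - transported G 2 (?x, 0))\<bar> \<le> Q * (c * exp (l * fst p))"
      unfolding abs_mult using Q j x by (intro mult_mono T') auto
    moreover have "\<bar>\<beta> j ?x * (transported F 3 (?x, 0) - transported G 3 (?x, 0))\<bar> \<le> Q * (c * exp (l * fst p))"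
      unfolding abs_mult using Q j x by (intro mult_mono T') auto
    ultimately have "\<bar>picard F j p - picard G j p\<bar> \<le> (1 + 2 * Q) * (c * exp (l * fst p))"
      using T[OF j p] by (simp add: algebra_simps)
    moreover have "(1 + 2 * Q) * c = M / 2"
    proof -
      have "l * m = 4 * K * (2 * (1 + 2 * Q))" using m_pos by (simp add: l_def)
      then have "c = M / (2 * (1 + 2 * Q))"
        unfolding c_def using K(1) by (metis mult_divide_mult_cancel_left mult_eq_0_iff order_less_irrefl zero_neq_numeral)
      moreover have "2 + 4 * Q \<noteq> 0" using Q(1) by simp
      ultimately show ?thesis by (simp add: field_simps)
    qed
    ultimately show ?thesis by (simp add: mult.assoc[symmetric])
  qed
  obtain F where F: "\<And>i. i \<in> {1..4} \<Longrightarrow> continuous_on triangle_domain (F i)"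
      "\<And>i p. i \<in> {1..4} \<Longrightarrow> p \<in> triangle_domain \<Longrightarrow> picard F i p = F i p"
    and uniq: "\<And>G i p. (\<And>i. i \<in> {1..4} \<Longrightarrow> continuous_on triangle_domain (G i)) \<Longrightarrow>
      (\<And>i p. i \<in> {1..4} \<Longrightarrow> p \<in> triangle_domain \<Longrightarrow> picard G i p = G i p) \<Longrightarrow>
      i \<in> {1..4} \<Longrightarrow> p \<in> triangle_domain \<Longrightarrow> G i p = F i p"
  proof (rule weighted_contraction_fixpoint[where \<Phi> = picard and J = "{1..4}" and S = triangle_domain
        and w = "\<lambda>p. exp (l * fst p)"])
    show "continuous_on triangle_domain (\<lambda>p. exp (l * fst p))" by (intro continuous_intros)
  qed (use compact_triangle_domain continuous_on_picard contraction that in \<open>auto simp del: atLeastAtMost_iff\<close>)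
  show thesis
  proof (rule that)
    show "solution F" using F by (subst solution_iff_picard_fixpoint) auto
    fix G i p assume G: "solution G" and ip: "i \<in> {1..4::nat}" "p \<in> triangle_domain"
    then have c: "\<And>i. i \<in> {1..4} \<Longrightarrow> continuous_on triangle_domain (G i)" by (simp add: solution_def)
    have "\<forall>j\<in>{1..4}. \<forall>p\<in>triangle_domain. picard G j p = G j p"
      by (rule iffD1[OF solution_iff_picard_fixpoint, OF _ G]) (rule c)
    then show "G i p = F i p" using c ip by (intro uniq) auto
  qed
qed

end

section \<open>The given system as an instance of \<open>characteristic_system\<close>\<close>

theorem theoremA1:
  fixes \<epsilon>1 \<epsilon>2 :: "real \<Rightarrow> real"
    and q h :: "nat \<Rightarrow> real \<Rightarrow> real"
    and g :: "nat \<Rightarrow> real \<times> real \<Rightarrow> real"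
    and C :: "nat \<Rightarrow> nat \<Rightarrow> real \<times> real \<Rightarrow> real"
  assumes "\<And>i. i \<in> {1..4} \<Longrightarrow> continuous_on {0..1} (q i)"
    and "\<And>i. i \<in> {1..4} \<Longrightarrow> continuous_on {0..1} (h i)"
    and "\<And>i. i \<in> {1..4} \<Longrightarrow> continuous_on triangle_domain (g i)"
    and "\<And>j i. j \<in> {1..4} \<Longrightarrow> i \<in> {1..4} \<Longrightarrow> continuous_on triangle_domain (C j i)"
    and "continuous_on {0..1} \<epsilon>1"
    and "continuous_on {0..1} \<epsilon>2"
    and "\<And>x. x \<in> {0..1} \<Longrightarrow> \<epsilon>1 x > 0"
    and "\<And>x. x \<in> {0..1} \<Longrightarrow> \<epsilon>2 x > 0"
  shows "\<exists>F. hyperbolic_solution \<epsilon>1 \<epsilon>2 q h g C F \<and>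
           (\<forall>G. hyperbolic_solution \<epsilon>1 \<epsilon>2 q h g C G \<longrightarrow>
              (\<forall>i\<in>{1..4}. \<forall>p\<in>triangle_domain. G i p = F i p))"
proof -
  have idx: "{1..4} = {1, 2, 3, 4 :: nat}" by auto
  define a where "a j = (if j \<in> {1, 2} then \<epsilon>1 else \<epsilon>2)" for j :: nat
  define b where "b j = (if j = 1 then \<epsilon>1 else if j = 2 then (\<lambda>\<xi>. - \<epsilon>2 \<xi>)
    else if j = 3 then (\<lambda>\<xi>. - \<epsilon>1 \<xi>) else \<epsilon>2)" for j :: nat
  define B where "B j = (if j \<in> {1, 4} then bottom_edge else diagonal_edge)" for j :: nat
  define \<alpha> where "\<alpha> j = (if j = 1 then q 1 else if j = 4 then q 3 else (\<lambda>_. 0))" for j :: nat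
  define \<beta> where "\<beta> j = (if j = 1 then q 2 else if j = 4 then q 4 else (\<lambda>_. 0))" for j :: nat
  note defs = a_def b_def B_def \<alpha>_def \<beta>_def
  have "\<forall>j\<in>{1..4}. \<exists>s X. characteristic_foliation (a j) (b j) (B j) s X"
    unfolding idx using bottom_foliation[OF assms(5,7)] bottom_foliation[OF assms(6,8)]
      diagonal_foliation[OF assms(5,7,6,8)] diagonal_foliation[OF assms(6,8,5,7)]
    by (simp add: defs)
  then obtain s X where fol: "\<And>j. j \<in> {1..4} \<Longrightarrow> characteristic_foliation (a j) (b j) (B j) (s j) (X j)"
    by metis
  \<comment> \<open>Positive minima of the two speeds, attained by compactness, give a common lower
    bound for the horizontal speed of all four families.\<close>
  obtain x1 where x1: "x1 \<in> {0..1}" "\<And>x. x \<in> {0..1} \<Longrightarrow> \<epsilon>1 x1 \<le> \<epsilon>1 x"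
    using continuous_attains_inf[OF _ _ assms(5)] by auto
  obtain x2 where x2: "x2 \<in> {0..1}" "\<And>x. x \<in> {0..1} \<Longrightarrow> \<epsilon>2 x2 \<le> \<epsilon>2 x"
    using continuous_attains_inf[OF _ _ assms(6)] by auto
  interpret characteristic_system a b B s X h \<alpha> \<beta> g C "min (\<epsilon>1 x1) (\<epsilon>2 x2)"
  proof (rule characteristic_system.intro)
    show "0 < min (\<epsilon>1 x1) (\<epsilon>2 x2)" using x1(1) x2(1) assms(7,8) by simp
    show "min (\<epsilon>1 x1) (\<epsilon>2 x2) \<le> a j x" if "x \<in> {0..1}" for j x
      using x1(2)[OF that] x2(2)[OF that] by (auto simp: a_def min_le_iff_disj)
    show "continuous_on {0..1} (\<alpha> j)" "continuous_on {0..1} (\<beta> j)" for j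
      using assms(1) by (auto simp: \<alpha>_def \<beta>_def)
    show "\<alpha> j x = 0" "\<beta> j x = 0" if "j \<in> {2, 3}" for j x
      using that by (auto simp: \<alpha>_def \<beta>_def)
  qed (use fol assms(2-4) in \<open>blast+\<close>)
  \<comment> \<open>Both edges lie in the triangle and are parametrised by the unit interval, which
    turns boundary conditions over points of \<open>B j\<close> into conditions over
    \<open>x\<close>.\<close>
  have bottom: "(\<forall>p\<in>triangle_domain \<inter> bottom_edge. P p) \<longleftrightarrow> (\<forall>x\<in>{0..1}. P (x, 0))" for P
    by (auto simp: triangle_domain_def bottom_edge_def)
  have diagonal: "(\<forall>p\<in>triangle_domain \<inter> diagonal_edge. P p) \<longleftrightarrow> (\<forall>x\<in>{0..1}. P (x, x))" for P
    by (auto simp: triangle_domain_def diagonal_edge_def)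
  have iff: "hyperbolic_solution \<epsilon>1 \<epsilon>2 q h g C F \<longleftrightarrow> solution F" for F
    unfolding hyperbolic_solution_def solution_def idx
    by (simp add: defs bottom diagonal ball_conj_distrib)
  obtain F where "solution F"
    "\<And>G i p. solution G \<Longrightarrow> i \<in> {1..4} \<Longrightarrow> p \<in> triangle_domain \<Longrightarrow> G i p = F i p"
    using ex_unique_solution by blast
  then show ?thesis unfolding iff by blast
qed

end
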